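(* Let $\mathcal{M}=\mathcal{M}(J,\{n_k\},\{\phi_k\})$ be a Moran class in $\mathbb{R}^d$, where $\phi_k=(c_{k,1},\dots,c_{k,n_k})$, with $c_*=\inf_{i,j}c_{i,j}>0$, and suppose that $c_{k,1}=c_{k,2}=\cdots=c_{k,n_k}=c_k$ for each $k\in\mathbb{N}$. Then for every $F\in\mathcal{M}$, $$\dim_A F=\lim_{m\to\infty}\left(\sup_{k\ge1}\frac{\log(n_k\cdots n_{k+m})}{-\log(c_k\cdots c_{k+m})}\right).$$
   Context: Assouad dimension: for a metric space $X$ and $0<r<R$, $N_{r,R}(X)$ is the smallest number $N$ such that every ball of radius $R$ in $X$ can be covered by $N$ balls of radius $r$. Then $$\dim_A(X)=\inf\{\alpha\ge 0:\ \exists\, b,c>0 \text{ such that } N_{r,R}(X)\le c(R/r)^\alpha \text{ for all } 0<r<R<b\}.$$ A subset of $\mathbb{R}^d$ is regarded as a metric space with the Euclidean metric. $|A|$ denotes the diameter of a set $A$, and $\mathrm{int}(A)$ its interior. Moran sets: let $\{n_k\}_{k\ge1}$ be a sequence of integers with $n_k\ge 2$. Let $D_k=\{u_1\cdots u_k: 1\le u_j\le n_j,\ j\le k\}$ be the set of words of length $k$, $D_0=\{\emptyset\}$ (the empty word), and $D=\bigcup_{k\ge0}D_k$. Let $J\subset\mathbb{R}^d$ be compact with $\mathrm{int}(J)\ne\varnothing$. For each $k\ge1$ let $\phi_k=(c_{k,1},\dots,c_{k,n_k})$ be a vector of positive reals with $\sum_{j=1}^{n_k}(c_{k,j})^d\le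 1$. A collection $\mathcal{F}=\{J_{\mathbf u}:\mathbf u\in D\}$ of closed subsets of $J$ has the Moran structure if: (1) for each $\mathbf u\in D$ there is a similarity $S_{\mathbf u}:\mathbb{R}^d\to\mathbb{R}^d$ with $J_{\mathbf u}=S_{\mathbf u}(J)$, and $J_\emptyset=J$; (2) for all $k\ge1$ and $\mathbf u\in D_{k-1}$, the sets $J_{\mathbf u1},\dots,J_{\mathbf un_k}$ are subsets of $J_{\mathbf u}$ with pairwise disjoint interiors, and $|J_{\mathbf ui}|/|J_{\mathbf u}|=c_{k,i}$ for $1\le i\le n_k$. The associated Moran set is $\bigcap_{k\ge1}\bigcup_{\mathbf u\in D_k}J_{\mathbf u}$. The Moran class $\mathcal{M}(J,\{n_k\},\{\phi_k\})$ is the class of all Moran sets obtained in this way from the given $J,\{n_k\},\{\phi_k\}$. *)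

theory Defs
  imports "HOL-Analysis.Analysis" "HOL-Library.Extended_Real"
begin

text \<open>A set \<open>X\<close> is viewed as a metric space with the restricted distance, so the balls of \<open>X\<close>
  are the sets \<open>X \<inter> ball x r\<close> with centre \<open>x \<in> X\<close>. The value is \<open>\<infinity>\<close> if no finite number suffices.\<close>

definition covering_number :: "real \<Rightarrow> real \<Rightarrow> 'a::metric_space set \<Rightarrow> enat" where
  "covering_number r R X =
     Inf {enat N | N. \<forall>x\<in>X. \<exists>T. T \<subseteq> X \<and> finite T \<and> card T \<le> N \<and>
                          X \<inter> ball x R \<subseteq> (\<Union>y\<in>T. X \<inter> ball y r)}"

text \<open>The infimum is taken in the extended reals, so that an empty set of exponents
  yields \<open>\<infinity>\<close>.\<close>

definition assouad_dim :: "'a::metric_space set \<Rightarrow> ereal" where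
  "assouad_dim X =
     Inf {ereal \<alpha> | \<alpha>. \<alpha> \<ge> 0 \<and>
       (\<exists>b>0. \<exists>c>0. \<forall>r R. 0 < r \<and> r < R \<and> R < b \<longrightarrow>
          ereal_of_enat (covering_number r R X) \<le> ereal (c * (R / r) powr \<alpha>))}"

definition similarity :: "('a::metric_space \<Rightarrow> 'a) \<Rightarrow> bool" where
  "similarity S \<longleftrightarrow> (\<exists>\<rho>>0. \<forall>x y. dist (S x) (S y) = \<rho> * dist x y)"

text \<open>Sequences \<open>n\<close> and \<open>\<phi>\<close> are indexed from 1 (their values at index 0 are irrelevant), whereas
  list positions start at 0; hence the shift in \<open>words\<close>.\<close>

definition words :: "(nat \<Rightarrow> nat) \<Rightarrow> nat \<Rightarrow> nat list set" where
  "words n k = {u. length u = k \<and> (\<forall>j<k. 1 \<le> u ! j \<and> u ! j \<le> n (Suc j))}"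

definition moran_data ::
  "'a::euclidean_space set \<Rightarrow> (nat \<Rightarrow> nat) \<Rightarrow> (nat \<Rightarrow> nat \<Rightarrow> real) \<Rightarrow> bool" where
  "moran_data J n \<phi> \<longleftrightarrow>
     compact J \<and> interior J \<noteq> {} \<and>
     (\<forall>k\<ge>1. n k \<ge> 2) \<and>
     (\<forall>k\<ge>1. \<forall>j\<in>{1..n k}. \<phi> k j > 0) \<and>
     (\<forall>k\<ge>1. (\<Sum>j=1..n k. \<phi> k j ^ DIM('a)) \<le> 1)"

definition moran_structure ::
  "'a::euclidean_space set \<Rightarrow> (nat \<Rightarrow> nat) \<Rightarrow> (nat \<Rightarrow> nat \<Rightarrow> real) \<Rightarrow> (nat list \<Rightarrow> 'a set) \<Rightarrow> bool"
where
  "moran_structure J n \<phi> \<J> \<longleftrightarrow>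
     (\<forall>k. \<forall>u\<in>words n k. closed (\<J> u) \<and> \<J> u \<subseteq> J) \<and>
     (\<forall>k. \<forall>u\<in>words n k. \<exists>S. similarity S \<and> \<J> u = S ` J) \<and>
     \<J> [] = J \<and>
     (\<forall>k\<ge>1. \<forall>u\<in>words n (k - 1).
        (\<forall>i\<in>{1..n k}. \<J> (u @ [i]) \<subseteq> \<J> u) \<and>
        (\<forall>i\<in>{1..n k}. \<forall>j\<in>{1..n k}. i \<noteq> j \<longrightarrow>
           interior (\<J> (u @ [i])) \<inter> interior (\<J> (u @ [j])) = {}) \<and>
        (\<forall>i\<in>{1..n k}. diameter (\<J> (u @ [i])) / diameter (\<J> u) = \<phi> k i))"

definition moran_set :: "(nat \<Rightarrow> nat) \<Rightarrow> (nat list \<Rightarrow> 'a set) \<Rightarrow> 'a set" where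
  "moran_set n \<J> = (\<Inter>k\<in>{1..}. \<Union>u\<in>words n k. \<J> u)"

definition moran_class ::
  "'a::euclidean_space set \<Rightarrow> (nat \<Rightarrow> nat) \<Rightarrow> (nat \<Rightarrow> nat \<Rightarrow> real) \<Rightarrow> 'a set set" where
  "moran_class J n \<phi> = {moran_set n \<J> | \<J>. moran_structure J n \<phi> \<J>}"

end

theory Submission
  imports Defs
begin

text \<open>The cells of level \<open>k\<close> all have the same diameter \<open>diam k\<close>, and by a volume comparison a ball
  whose radius is comparable to \<open>diam k\<close> meets boundedly many of them. Hence, for radii of order
  \<open>diam k\<close> and \<open>diam l\<close>, the covering number is comparable to the number of cells of level \<open>l\<close> below a
  cell of level \<open>k\<close>, and \<open>\<alpha>\<close> is an admissible exponent iff
  \<open>log (n\<^sub>k\<^sub>+\<^sub>1 \<cdots> n\<^sub>l) \<le> \<alpha> (- log (c\<^sub>k\<^sub>+\<^sub>1 \<cdots> c\<^sub>l)) + O(1)\<close> uniformly in \<open>k \<le> l\<close>. Cutting \<open>{k+1..l}\<close> into blocks of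
  length \<open>m + 1\<close> shows that \<open>\<alpha> = sup\<^sub>k rate k m\<close> is admissible for every \<open>m\<close>; conversely,
  dividing by \<open>- log (c\<^sub>k \<cdots> c\<^sub>k\<^sub>+\<^sub>m) \<ge> \<gamma> (m + 1)\<close> shows that every admissible exponent bounds the
  limit superior of these suprema.\<close>

section \<open>Covering numbers and similarities\<close>

text \<open>A nonempty set of extended naturals attains its infimum, and the covering condition is
  monotone in \<open>N\<close>; the empty set has infimum \<infinity>, which is excluded by the
  finite bound.\<close>

lemma covering_number_le_iff:
  "covering_number r R X \<le> enat N \<longleftrightarrow>
     (\<forall>x\<in>X. \<exists>T. T \<subseteq> X \<and> finite T \<and> card T \<le> N \<and> X \<inter> ball x R \<subseteq> (\<Union>y\<in>T. X \<inter> ball y r))"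
  (is "_ \<longleftrightarrow> ?P N")
proof
  let ?A = "{enat N | N. ?P N}"
  assume le: "covering_number r R X \<le> enat N"
  have "?A \<noteq> {}"
  proof
    assume "?A = {}"
    then have "covering_number r R X = \<infinity>"
      unfolding covering_number_def by (simp only: Inf_enat_def) simp
    with le show False by simp
  qed
  then obtain a where "a \<in> ?A" by (meson ex_in_conv)
  then have "Inf ?A \<in> ?A"
    by (rule wellorder_InfI)
  then have "\<exists>N'. covering_number r R X = enat N' \<and> ?P N'"
    unfolding covering_number_def by (rule CollectD)
  then obtain N' where N': "covering_number r R X = enat N'" "?P N'"
    by (elim exE conjE)
  then have "N' \<le> N"
    using le by simp
  then show "?P N"
    using N'(2) by (meson order_trans)
next
  assume "?P N"
  then show "covering_number r R X \<le> enat N"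
    unfolding covering_number_def by (intro Inf_lower CollectI exI[of _ N] conjI refl)
qed

text \<open>Normalising the ratio and the value at 0 leaves an isometry fixing 0, hence an
  orthogonal map, which is onto in finite dimension.\<close>

lemma similarity_surj:
  fixes S :: "'a::euclidean_space \<Rightarrow> 'a"
  assumes "similarity S"
  shows "surj S"
proof -
  obtain \<rho> where \<rho>: "\<rho> > 0" "\<And>x y. dist (S x) (S y) = \<rho> * dist x y"
    using assms unfolding similarity_def by blast
  define T where "T x = (1 / \<rho>) *\<^sub>R (S x - S 0)" for x
  have "dist (T x) (T y) = dist x y" for x y
  proof -
    have "T x - T y = (1 / \<rho>) *\<^sub>R (S x - S y)"
      by (simp add: T_def algebra_simps)
    then show ?thesis
      using \<rho> by (simp add: dist_norm)
  qed
  then have "orthogonal_transformation T"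
    by (simp add: orthogonal_transformation_isometry T_def)
  then have "surj T"
    by (rule orthogonal_transformation_surj)
  have "\<exists>x. y = S x" for y
  proof -
    obtain x where "T x = (1 / \<rho>) *\<^sub>R (y - S 0)"
      using \<open>surj T\<close> by (metis surjD)
    then show ?thesis
      using \<rho>(1) by (auto simp: T_def)
  qed
  then show ?thesis by blast
qed

lemma diameter_scaling_image:
  fixes S :: "'a::real_normed_vector \<Rightarrow> 'b::real_normed_vector"
  assumes "\<rho> > 0" and S: "\<And>x y. dist (S x) (S y) = \<rho> * dist x y" and "bounded X"
  shows "diameter (S ` X) = \<rho> * diameter X"
proof (rule antisym)
  show "diameter (S ` X) \<le> \<rho> * diameter X"
    using assms diameter_bounded_bound[OF \<open>bounded X\<close>] diameter_ge_0[OF \<open>bounded X\<close>]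
    by (intro diameter_le) (auto simp flip: dist_norm)
  have "bounded (S ` X)"
    unfolding bounded_two_points
    using assms diameter_bounded_bound[OF \<open>bounded X\<close>]
    by (intro exI[of _ "\<rho> * diameter X"]) auto
  then have "\<rho> * dist x y \<le> diameter (S ` X)" if "x \<in> X" "y \<in> X" for x y
    using that diameter_bounded_bound[of "S ` X" "S x" "S y"] S by auto
  then have "diameter X \<le> diameter (S ` X) / \<rho>"
    using \<open>\<rho> > 0\<close> diameter_ge_0[OF \<open>bounded (S ` X)\<close>]
    by (intro diameter_le) (auto simp: field_simps simp flip: dist_norm)
  then show "\<rho> * diameter X \<le> diameter (S ` X)"
    using \<open>\<rho> > 0\<close> by (simp add: field_simps)
qed

text \<open>By surjectivity the image of a ball is a full ball, with radius scaled by the ratio of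
  \<open>S\<close>. The ratio is written as a quotient of diameters because a Moran structure
  prescribes only the diameters of its cells.\<close>

lemma similarity_image_ball:
  fixes S :: "'a::euclidean_space \<Rightarrow> 'a"
  assumes "similarity S" "bounded X" "diameter X > 0" "ball z e \<subseteq> X"
  shows "ball (S z) (e * diameter (S ` X) / diameter X) \<subseteq> S ` X"
proof
  obtain \<rho> where \<rho>: "\<rho> > 0" "\<And>x y. dist (S x) (S y) = \<rho> * dist x y"
    using assms unfolding similarity_def by blast
  fix y assume y: "y \<in> ball (S z) (e * diameter (S ` X) / diameter X)"
  obtain x where "y = S x"
    using similarity_surj[OF assms(1)] by (metis surjD)
  with y have "x \<in> ball z e"
    using diameter_scaling_image[OF \<rho> assms(2)] \<rho> assms(3) by (simp add: mult.commute)
  with \<open>y = S x\<close> show "y \<in> S ` X"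
    using assms(4) by blast
qed

section \<open>Words and their extensions\<close>

lemma words_0 [simp]: "words n 0 = {[]}"
  by (auto simp: words_def)

lemma words_Suc: "words n (Suc k) = (\<lambda>(u, i). u @ [i]) ` (words n k \<times> {1..n (Suc k)})"
proof (intro equalityI subsetI)
  fix u assume u: "u \<in> words n (Suc k)"
  then obtain v i where vi: "u = v @ [i]"
    by (cases u rule: rev_cases) (auto simp: words_def)
  with u have "length v = k" by (auto simp: words_def)
  have *: "1 \<le> u ! j \<and> u ! j \<le> n (Suc j)" if "j < Suc k" for j
    using u that by (auto simp: words_def)
  have "v \<in> words n k"
    unfolding words_def
  proof (intro CollectI conjI allI impI)
    fix j assume "j < k"
    then show "1 \<le> v ! j" "v ! j \<le> n (Suc j)"
      using *[of j] \<open>length v = k\<close> by (simp_all add: vi nth_append)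
  qed fact
  moreover have "i \<in> {1..n (Suc k)}"
    using *[of k] \<open>length v = k\<close> unfolding vi by (auto simp: nth_append)
  ultimately show "u \<in> (\<lambda>(u, i). u @ [i]) ` (words n k \<times> {1..n (Suc k)})"
    using vi by auto
qed (auto simp: words_def nth_append less_Suc_eq)

lemma length_words: "u \<in> words n k \<Longrightarrow> length u = k"
  by (simp add: words_def)

lemma take_words: "u \<in> words n l \<Longrightarrow> k \<le> l \<Longrightarrow> take k u \<in> words n k"
  by (auto simp: words_def)

lemma finite_words: "finite (words n k)"
  by (induction k) (auto simp: words_Suc)

lemma card_words_prefix:
  assumes "u \<in> words n k" "k \<le> l"
  shows "card {v \<in> words n l. take k v = u} = (\<Prod>i=Suc k..l. n i)"
  using assms(2)
proof (induction l rule: dec_induct)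
  case base
  have "{v \<in> words n k. take k v = u} = {u}"
    using assms(1) by (auto simp: words_def)
  then show ?case by simp
next
  case (step l)
  let ?A = "{v \<in> words n l. take k v = u}"
  have "{v \<in> words n (Suc l). take k v = u} = (\<lambda>(v, i). v @ [i]) ` (?A \<times> {1..n (Suc l)})"
    using \<open>k \<le> l\<close> by (auto simp: words_Suc length_words)
  then have "card {v \<in> words n (Suc l). take k v = u} = card (?A \<times> {1..n (Suc l)})"
    by (simp add: card_image inj_on_def)
  then show ?case
    using step by (simp add: card_cartesian_product)
qed

section \<open>Packing by volume\<close>

text \<open>The volumes of the disjoint small balls add up to at most that of the large ball. The
  common scale \<open>s\<close> cancels, so the bound is the same at every level.\<close>

lemma card_disjoint_balls_le:
  fixes w :: "'i \<Rightarrow> 'a::euclidean_space"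
  assumes "finite I" "s > 0" "\<rho> > 0"
    and disj: "\<And>i j. i \<in> I \<Longrightarrow> j \<in> I \<Longrightarrow> i \<noteq> j \<Longrightarrow> ball (w i) (\<rho> * s) \<inter> ball (w j) (\<rho> * s) = {}"
    and sub: "\<And>i. i \<in> I \<Longrightarrow> ball (w i) (\<rho> * s) \<subseteq> ball x (B * s)"
    and "B \<ge> 0"
  shows "real (card I) \<le> (B / \<rho>) ^ DIM('a)"
proof -
  let ?v = "unit_ball_vol (real DIM('a))"
  have v: "?v > 0" by simp
  have [simp]: "ball y r \<in> fmeasurable lborel" for y :: 'a and r
    using emeasure_lborel_ball_finite[of y r] by (intro fmeasurableI) auto
  have "real (card I) * (?v * (\<rho> * s) ^ DIM('a)) = (\<Sum>i\<in>I. measure lborel (ball (w i) (\<rho> * s)))"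
    using assms by (simp add: content_ball)
  also have "\<dots> = measure lborel (\<Union>i\<in>I. ball (w i) (\<rho> * s))"
    using assms by (intro measure_UNION'[symmetric]) (auto simp: pairwise_def disjnt_def)
  also have "\<dots> \<le> measure lborel (ball x (B * s))"
    using sub by (intro measure_mono_fmeasurable) (auto intro!: borel_open)
  also have "\<dots> = ?v * (B * s) ^ DIM('a)"
    using assms by (simp add: content_ball)
  finally have "real (card I) * \<rho> ^ DIM('a) \<le> B ^ DIM('a)"
    using v assms by (simp add: power_mult_distrib mult.left_commute)
  then show ?thesis
    using assms by (simp add: power_divide field_simps)
qed

section \<open>Homogeneous Moran structures: cell counts and diameters\<close>

text \<open>The constant \<delta> is a uniform positive lower bound for the ratios; the final
  theorem takes the infimum of all ratios for it.\<close>

locale homogeneous_moran =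
  fixes J :: "'a::euclidean_space set" and n :: "nat \<Rightarrow> nat" and \<phi> :: "nat \<Rightarrow> nat \<Rightarrow> real"
    and c :: "nat \<Rightarrow> real" and \<J> :: "nat list \<Rightarrow> 'a set" and \<delta> :: real
  assumes data: "moran_data J n \<phi>"
    and ratios: "\<And>k j. k \<ge> 1 \<Longrightarrow> j \<in> {1..n k} \<Longrightarrow> \<phi> k j = c k"
    and struct: "moran_structure J n \<phi> \<J>"
    and \<delta>_pos: "\<delta> > 0" and \<delta>_le: "\<And>k. k \<ge> 1 \<Longrightarrow> \<delta> \<le> c k"
begin

abbreviation "F \<equiv> moran_set n \<J>"

definition ncells :: "nat \<Rightarrow> real" where "ncells k = (\<Prod>i=1..k. real (n i))"

definition diam :: "nat \<Rightarrow> real" where "diam k = diameter J * (\<Prod>i=1..k. c i)"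

lemma n_ge_2: "k \<ge> 1 \<Longrightarrow> n k \<ge> 2"
  using data by (auto simp: moran_data_def)

lemma c_pos: "k \<ge> 1 \<Longrightarrow> c k > 0"
  using \<delta>_pos \<delta>_le by force

lemma n_c_le_1: "k \<ge> 1 \<Longrightarrow> real (n k) * c k ^ DIM('a) \<le> 1"
proof -
  assume k: "k \<ge> 1"
  have "(\<Sum>j=1..n k. \<phi> k j ^ DIM('a)) = (\<Sum>j=1..n k. c k ^ DIM('a))"
    using k ratios by (intro sum.cong) auto
  then show ?thesis
    using data k by (auto simp: moran_data_def)
qed

text \<open>As \<open>n k \<ge> 2\<close>, the volume condition keeps the ratios away from 1.\<close>

definition \<gamma> :: real where "\<gamma> = ln 2 / DIM('a)"

lemma \<gamma>_pos: "\<gamma> > 0" by (simp add: \<gamma>_def)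

lemma ln_n_le:
  assumes "k \<ge> 1" shows "ln (real (n k)) \<le> - DIM('a) * ln (c k)"
proof -
  have "ln (real (n k) * c k ^ DIM('a)) \<le> ln 1"
    using n_c_le_1[OF assms] c_pos[OF assms] n_ge_2[OF assms] by (subst ln_le_cancel_iff) auto
  then show ?thesis
    using c_pos[OF assms] n_ge_2[OF assms] by (simp add: ln_mult ln_realpow)
qed

lemma ln_c_le:
  assumes "k \<ge> 1" shows "\<gamma> \<le> - ln (c k)"
proof -
  have "ln 2 \<le> ln (real (n k))"
    using n_ge_2[OF assms] by simp
  with ln_n_le[OF assms] show ?thesis
    by (simp add: \<gamma>_def field_simps)
qed

lemma c_less_1: "k \<ge> 1 \<Longrightarrow> c k < 1"
  using ln_c_le[of k] \<gamma>_pos c_pos[of k] by (simp add: ln_less_zero_iff[symmetric] del: ln_less_zero_iff)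

lemma \<delta>_less_1: "\<delta> < 1"
  using c_less_1[of 1] \<delta>_le[of 1] by simp

lemma bounded_J: "bounded J"
  using data by (auto simp: moran_data_def compact_imp_bounded)

lemma inner_ball: obtains z e where "e > 0" "ball z e \<subseteq> J"
  using data unfolding moran_data_def by (metis equals0I mem_interior)

lemma diameter_J_pos: "diameter J > 0"
proof -
  obtain z e where "e > 0" "ball z e \<subseteq> J" by (rule inner_ball)
  then have "2 * e \<le> diameter J"
    using diameter_subset[OF \<open>ball z e \<subseteq> J\<close> bounded_J] by simp
  with \<open>e > 0\<close> show ?thesis by simp
qed

lemma ncells_0 [simp]: "ncells 0 = 1" and ncells_Suc: "ncells (Suc k) = ncells k * n (Suc k)"
  by (simp_all add: ncells_def)

lemma diam_0 [simp]: "diam 0 = diameter J" and diam_Suc: "diam (Suc k) = diam k * c (Suc k)"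
  by (simp_all add: diam_def)

lemma ncells_Suc_ge: "ncells k \<le> ncells (Suc k)" and ncells_pos: "ncells k > 0"
proof -
  show "ncells k > 0" for k
  proof (induction k)
    case (Suc k)
    then show ?case using n_ge_2[of "Suc k"] by (simp add: ncells_Suc)
  qed simp
  then show "ncells k \<le> ncells (Suc k)"
    using n_ge_2[of "Suc k"] by (simp add: ncells_Suc)
qed

lemma diam_pos: "diam k > 0"
proof (induction k)
  case (Suc k)
  then show ?case using c_pos[of "Suc k"] by (simp add: diam_Suc)
qed (simp add: diameter_J_pos)

lemma ncells_mono: "k \<le> l \<Longrightarrow> ncells k \<le> ncells l"
  using ncells_Suc_ge by (rule lift_Suc_mono_le)

lemma diam_Suc_less: "diam (Suc k) < diam k"
  using diam_pos[of k] c_less_1[of "Suc k"] by (simp add: diam_Suc)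

lemma diam_antimono: "k \<le> l \<Longrightarrow> diam l \<le> diam k"
  using diam_Suc_less[THEN less_imp_le] by (rule lift_Suc_antimono_le)

lemma diam_Suc_ge: "\<delta> * diam k \<le> diam (Suc k)"
  using diam_pos[of k] \<delta>_le[of "Suc k"] by (simp add: diam_Suc)

text \<open>The block of factors with indices \<open>k\<close> to \<open>k + m\<close> leads from
  level \<open>k - 1\<close> to level \<open>k + m\<close>, so it spans \<open>m + 1\<close>
  levels.\<close>

lemma ncells_block: "k \<ge> 1 \<Longrightarrow> (\<Prod>i=k..k+m. real (n i)) = ncells (k + m) / ncells (k - 1)"
proof (induction m)
  case 0
  then show ?case using ncells_pos[of "k - 1"] by (cases k) (auto simp: ncells_Suc)
qed (simp add: ncells_Suc)

lemma diam_block: "k \<ge> 1 \<Longrightarrow> (\<Prod>i=k..k+m. c i) = diam (k + m) / diam (k - 1)"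
proof (induction m)
  case 0
  then show ?case using diam_pos[of "k - 1"] by (cases k) (auto simp: diam_Suc)
qed (simp add: diam_Suc)

lemma card_words_prefix_real:
  assumes "u \<in> words n k" "k \<le> l"
  shows "real (card {v \<in> words n l. take k v = u}) = ncells l / ncells k"
proof -
  have "ncells l = ncells k * (\<Prod>i=Suc k..l. real (n i))"
    using assms(2) by (induction l rule: dec_induct) (simp_all add: ncells_Suc)
  then show ?thesis
    using ncells_pos[of k] by (simp add: card_words_prefix[OF assms])
qed

subsection \<open>Cells\<close>

lemma cell_child:
  assumes "u \<in> words n k" "i \<in> {1..n (Suc k)}"
  shows "\<J> (u @ [i]) \<subseteq> \<J> u" and "diameter (\<J> (u @ [i])) / diameter (\<J> u) = c (Suc k)"
  using struct assms ratios[of "Suc k" i] unfolding moran_structure_def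
  by (metis diff_Suc_1 le_add1 plus_1_eq_Suc)+

lemma cell_disjoint_siblings:
  assumes "u \<in> words n k" "i \<in> {1..n (Suc k)}" "j \<in> {1..n (Suc k)}" "i \<noteq> j"
  shows "interior (\<J> (u @ [i])) \<inter> interior (\<J> (u @ [j])) = {}"
  using struct assms unfolding moran_structure_def
  by (metis diff_Suc_1 le_add1 plus_1_eq_Suc)

lemma cell_similar: "u \<in> words n k \<Longrightarrow> \<exists>S. similarity S \<and> \<J> u = S ` J"
  using struct unfolding moran_structure_def by blast

lemma cell_subset: "u \<in> words n k \<Longrightarrow> \<J> u \<subseteq> J"
  using struct unfolding moran_structure_def by blast

lemma cell_bounded: "u \<in> words n k \<Longrightarrow> bounded (\<J> u)"
  by (rule bounded_subset[OF bounded_J cell_subset])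

lemma cell_compact: "u \<in> words n k \<Longrightarrow> compact (\<J> u)"
  using struct cell_bounded[of u k] by (auto simp: moran_structure_def compact_eq_bounded_closed)

lemma cell_nonempty: "u \<in> words n k \<Longrightarrow> \<J> u \<noteq> {}"
  using cell_similar[of u k] diameter_J_pos by auto

lemma diameter_cell: "u \<in> words n k \<Longrightarrow> diameter (\<J> u) = diam k"
proof (induction k arbitrary: u)
  case 0
  then show ?case using struct by (simp add: moran_structure_def)
next
  case (Suc k)
  then obtain v i where vi: "u = v @ [i]" "v \<in> words n k" "i \<in> {1..n (Suc k)}"
    by (auto simp: words_Suc)
  have "diameter (\<J> u) / diam k = c (Suc k)"
    using cell_child(2)[OF vi(2,3)] Suc.IH[OF vi(2)] vi(1) by simp
  then show ?case
    using diam_pos[of k] by (simp add: diam_Suc field_simps)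
qed

lemma cell_prefix: "k \<le> l \<Longrightarrow> u \<in> words n l \<Longrightarrow> \<J> u \<subseteq> \<J> (take k u)"
proof (induction l arbitrary: u rule: dec_induct)
  case base
  then show ?case by (simp add: words_def)
next
  case (step l)
  then obtain v i where vi: "u = v @ [i]" "v \<in> words n l" "i \<in> {1..n (Suc l)}"
    by (auto simp: words_Suc)
  then have "\<J> u \<subseteq> \<J> (take k v)"
    using cell_child(1)[OF vi(2,3)] step.IH[OF vi(2)] by simp
  also have "take k v = take k u"
    using vi step.hyps by (simp add: words_def)
  finally show ?case .
qed

text \<open>Distinct words of equal length either have distinct parents, whose interiors are
  disjoint by induction and contain those of the children, or are siblings.\<close>

lemma cell_disjoint:
  "u \<in> words n k \<Longrightarrow> v \<in> words n k \<Longrightarrow> u \<noteq> v \<Longrightarrow> interior (\<J> u) \<inter> interior (\<J> v) = {}"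
proof (induction k arbitrary: u v)
  case (Suc k)
  obtain u' i where u: "u = u' @ [i]" "u' \<in> words n k" "i \<in> {1..n (Suc k)}"
    using Suc.prems(1) by (auto simp: words_Suc)
  obtain v' j where v: "v = v' @ [j]" "v' \<in> words n k" "j \<in> {1..n (Suc k)}"
    using Suc.prems(2) by (auto simp: words_Suc)
  show ?case
  proof (cases "u' = v'")
    case True
    then show ?thesis using cell_disjoint_siblings[OF u(2,3) v(3)] u v Suc.prems by auto
  next
    case False
    then have "interior (\<J> u') \<inter> interior (\<J> v') = {}"
      by (rule Suc.IH[OF u(2) v(2)])
    moreover have "interior (\<J> u) \<subseteq> interior (\<J> u')" "interior (\<J> v) \<subseteq> interior (\<J> v')"
      unfolding u(1) v(1) using cell_child(1)[OF u(2,3)] cell_child(1)[OF v(2,3)]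
      by (simp_all add: interior_mono)
    ultimately show ?thesis by blast
  qed
qed simp

lemma moran_set_covered:
  assumes "x \<in> F" shows "\<exists>u\<in>words n k. x \<in> \<J> u"
proof (cases "k \<ge> 1")
  case True
  then show ?thesis using assms by (auto simp: moran_set_def)
next
  \<comment> \<open>The intersection defining \<open>F\<close> starts at level 1; at level 0 the
    only cell is \<open>J\<close>.\<close>
  case False
  obtain u where "u \<in> words n 1" "x \<in> \<J> u"
    using assms unfolding moran_set_def by blast
  then have "x \<in> J" using cell_subset by blast
  moreover have "\<J> [] = J" using struct by (simp add: moran_structure_def)
  ultimately show ?thesis using False by (simp add: not_le)
qed

text \<open>Appending the digit 1 repeatedly yields a decreasing sequence of nonempty compact cells;
  a common point of them lies in \<open>F\<close>.\<close>

lemma moran_set_meets_cell: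
  assumes u: "u \<in> words n k"
  shows "F \<inter> \<J> u \<noteq> {}"
proof -
  define w where "w m = u @ replicate m 1" for m
  have w: "w m \<in> words n (k + m)" for m
  proof (induction m)
    case (Suc m)
    have "w (Suc m) = w m @ [1]" by (simp add: w_def replicate_append_same)
    then show ?case using Suc n_ge_2[of "Suc (k + m)"] by (auto simp: words_Suc)
  qed (simp add: w_def u)
  have step: "\<J> (w l) \<subseteq> \<J> (w m)" if "m \<le> l" for m l
  proof -
    have "take (k + m) (w l) = w m"
      using that u by (simp add: w_def words_def)
    then show ?thesis using cell_prefix[OF _ w[of l], of "k + m"] that by simp
  qed
  have "\<Inter>(range (\<lambda>m. \<J> (w m))) \<noteq> {}"
    using w step by (intro compact_nest) (auto intro: cell_compact dest: cell_nonempty)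
  then obtain x where x: "\<And>m. x \<in> \<J> (w m)" by blast
  \<comment> \<open>The word \<open>w j\<close> has length \<open>k + j\<close>, so its prefix of
    length \<open>j\<close> supplies a cell at every level, including those above
    \<open>u\<close>.\<close>
  have "\<exists>v\<in>words n j. x \<in> \<J> v" for j
    using cell_prefix[OF _ w[of j], of j] take_words[OF w[of j], of j] x[of j] by auto
  then have "x \<in> F" by (auto simp: moran_set_def)
  moreover have "x \<in> \<J> u" using x[of 0] by (simp add: w_def)
  ultimately show ?thesis by blast
qed

text \<open>Each cell of level \<open>k\<close> contains a ball of radius
  \<open>\<rho> * diam k\<close>, and these balls are disjoint. Cells meeting the given ball lie in
  the concentric ball of radius \<open>(A + 1) * diam k\<close>, so the volume bound applies with a
  constant independent of \<open>k\<close> and \<open>x\<close>.\<close>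

lemma card_cells_meeting_ball:
  assumes "A \<ge> 0"
  obtains M :: nat where "M > 0"
    "\<And>k x R. R \<le> A * diam k \<Longrightarrow> card {u \<in> words n k. \<J> u \<inter> ball x R \<noteq> {}} \<le> M"
proof -
  obtain z e where e: "e > 0" "ball z e \<subseteq> J" by (rule inner_ball)
  define \<rho> where "\<rho> = e / diameter J"
  have \<rho>: "\<rho> > 0" using e diameter_J_pos by (simp add: \<rho>_def)
  define q where "q = ((A + 1) / \<rho>) ^ DIM('a)"
  have q: "real (card {u \<in> words n k. \<J> u \<inter> ball x R \<noteq> {}}) \<le> q"
    if R: "R \<le> A * diam k" for k x R
  proof -
    let ?I = "{u \<in> words n k. \<J> u \<inter> ball x R \<noteq> {}}"
    have "\<exists>w. ball w (\<rho> * diam k) \<subseteq> \<J> u" if u: "u \<in> words n k" for u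
    proof -
      obtain S where S: "similarity S" "\<J> u = S ` J"
        using cell_similar[OF u] by blast
      then show ?thesis
        using similarity_image_ball[OF S(1) bounded_J diameter_J_pos e(2)] diameter_cell[OF u]
        by (auto simp: \<rho>_def)
    qed
    then obtain w where w: "\<And>u. u \<in> words n k \<Longrightarrow> ball (w u) (\<rho> * diam k) \<subseteq> \<J> u"
      by metis
    then have wi: "ball (w u) (\<rho> * diam k) \<subseteq> interior (\<J> u)" if "u \<in> words n k" for u
      using that by (simp add: interior_maximal)
    have sub: "\<J> u \<subseteq> ball x ((A + 1) * diam k)" if "u \<in> ?I" for u
    proof
      fix y assume y: "y \<in> \<J> u"
      from that obtain p where p: "p \<in> \<J> u" "dist x p < R" "u \<in> words n k" by auto
      have "dist p y \<le> diam k"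
        using diameter_bounded_bound[OF cell_bounded[OF p(3)] p(1) y] diameter_cell p by simp
      then have "dist x y < R + diam k"
        using p dist_triangle[of x y p] by simp
      with R show "y \<in> ball x ((A + 1) * diam k)" by (simp add: algebra_simps)
    qed
    show ?thesis
      unfolding q_def
    proof (rule card_disjoint_balls_le)
      show "ball (w u) (\<rho> * diam k) \<inter> ball (w v) (\<rho> * diam k) = {}" if "u \<in> ?I" "v \<in> ?I" "u \<noteq> v" for u v
        using wi[of u] wi[of v] cell_disjoint[of u k v] that by auto
      show "ball (w u) (\<rho> * diam k) \<subseteq> ball x ((A + 1) * diam k)" if "u \<in> ?I" for u
        using w[of u] sub[OF that] that by auto
    qed (use diam_pos[of k] \<rho> assms finite_words[of n k] in simp_all)
  qed
  show ?thesis
  \<comment> \<open>The successor makes the bound positive.\<close>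
  proof (rule that[of "Suc (nat \<lfloor>q\<rfloor>)"])
    fix k x R assume "R \<le> A * diam k"
    from q[OF this, of x] show "card {u \<in> words n k. \<J> u \<inter> ball x R \<noteq> {}} \<le> Suc (nat \<lfloor>q\<rfloor>)"
      by linarith
  qed simp
qed

subsection \<open>From growth of the cell counts to the dimension and back\<close>

lemma ln_diam_diff_ge:
  assumes "k \<le> l" shows "\<gamma> * (real l - real k) \<le> ln (diam k) - ln (diam l)"
  using assms
proof (induction l rule: dec_induct)
  case (step l)
  have "ln (diam (Suc l)) = ln (diam l) + ln (c (Suc l))"
    using diam_pos[of l] c_pos[of "Suc l"] by (simp add: diam_Suc ln_mult)
  then show ?case
    using step.IH ln_c_le[of "Suc l"] by (simp add: algebra_simps)
qed simp

lemma ex_diam_le: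
  assumes "R > 0" shows "\<exists>k. diam k \<le> R"
proof -
  obtain k :: nat where k: "(ln (diam 0) - ln R) / \<gamma> \<le> real k"
    using real_arch_simple by blast
  then have "ln (diam 0) - ln R \<le> \<gamma> * real k"
    using \<gamma>_pos by (simp add: field_simps)
  then have "ln (diam k) \<le> ln R"
    using ln_diam_diff_ge[of 0 k] by simp
  then show ?thesis
    using diam_pos[of k] assms by auto
qed

lemma ex_level:
  assumes "0 < R" "R < diameter J"
  obtains k where "diam (Suc k) \<le> R" "R < diam k"
proof -
  obtain m where "diam m \<le> R" using ex_diam_le[OF assms(1)] by blast
  then have "\<exists>k<m. (\<forall>i\<le>k. \<not> diam i \<le> R) \<and> diam (Suc k) \<le> R"
    using assms(2) by (intro ex_least_nat_less) auto
  then show ?thesis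
    using that by (meson le_refl not_le)
qed

text \<open>Choose levels \<open>k\<close>, \<open>l\<close> with diameters comparable to
  \<open>R\<close>, \<open>r\<close>. A ball of radius \<open>R\<close> meets boundedly many cells
  of level \<open>k\<close>, hence at most a constant times \<open>ncells l / ncells k\<close> cells
  of level \<open>l\<close>; one point of \<open>F\<close> in each of these gives the centres of a
  cover.\<close>

lemma assouad_dim_le:
  assumes "s \<ge> 0" "K > 0" and growth: "\<And>k l. k \<le> l \<Longrightarrow> ncells l / ncells k \<le> K * (diam k / diam l) powr s"
  shows "assouad_dim F \<le> ereal s"
proof -
  obtain M :: nat where M: "M > 0"
    "\<And>k x R. R \<le> (1 / \<delta>) * diam k \<Longrightarrow> card {u \<in> words n k. \<J> u \<inter> ball x R \<noteq> {}} \<le> M"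
    using card_cells_meeting_ball[of "1 / \<delta>"] \<delta>_pos by auto
  define C where "C = M * K * (2 / \<delta>) powr s"
  have C: "C > 0" using M \<open>K > 0\<close> \<delta>_pos by (simp add: C_def)
  have bound: "ereal_of_enat (covering_number r R F) \<le> ereal (C * (R / r) powr s)"
    if rR: "0 < r" "r < R" "R < diameter J" for r R
  proof -
    obtain k0 where k0: "diam (Suc k0) \<le> R" "R < diam k0"
      using ex_level[of R] rR by auto
    \<comment> \<open>Halving \<open>r\<close> gives \<open>diam l < r\<close> strictly, as open
      balls of radius \<open>r\<close> must contain whole cells of level \<open>l\<close>. This is
      the source of the factor 2 in \<open>C\<close>.\<close>
    obtain l0 where l0: "diam (Suc l0) \<le> r / 2" "r / 2 < diam l0"
      using ex_level[of "r / 2"] rR by auto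
    define k l where "k = Suc k0" and "l = Suc l0"
    \<comment> \<open>Otherwise \<open>R < diam k0 \<le> diam l \<le> r / 2 < R\<close>.\<close>
    have "\<not> l \<le> k0"
      using diam_antimono[of l k0] k0 l0 rR by (auto simp: l_def)
    then have kl: "k \<le> l" by (simp add: k_def)
    have Rk: "R \<le> (1 / \<delta>) * diam k"
    proof -
      have "\<delta> * R \<le> \<delta> * diam k0" using k0 \<delta>_pos by (intro mult_left_mono) auto
      also have "\<dots> \<le> diam k" unfolding k_def by (rule diam_Suc_ge)
      finally show ?thesis using \<delta>_pos by (simp add: field_simps)
    qed
    have Dk: "diam k \<le> R" and Dlr: "diam l < r" using k0 l0 rR by (auto simp: k_def l_def)
    have "\<delta> * (r / 2) \<le> \<delta> * diam l0"
      using l0 \<delta>_pos by (intro mult_left_mono) auto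
    then have Dl: "\<delta> * (r / 2) \<le> diam l"
      using diam_Suc_ge[of l0] by (simp add: l_def)
    define N where "N = M * (\<Prod>i=Suc k..l. n i)"
    have "covering_number r R F \<le> enat N"
      unfolding covering_number_le_iff
    proof
      fix x assume "x \<in> F"
      define U where "U = {u \<in> words n k. \<J> u \<inter> ball x R \<noteq> {}}"
      define V where "V = {v \<in> words n l. \<J> v \<inter> ball x R \<noteq> {}}"
      have fin: "finite U" "finite V" by (simp_all add: U_def V_def finite_words)
      \<comment> \<open>The centres of the cover have to belong to \<open>F\<close> itself.\<close>
      have "\<exists>p. p \<in> F \<inter> \<J> v" if "v \<in> words n l" for v
        using moran_set_meets_cell[OF that] by blast
      then obtain p where p: "\<And>v. v \<in> words n l \<Longrightarrow> p v \<in> F \<inter> \<J> v" by metis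
      have "V \<subseteq> (\<Union>u\<in>U. {v \<in> words n l. take k v = u})"
      proof
        fix v assume v: "v \<in> V"
        then have "take k v \<in> U"
          using cell_prefix[OF kl, of v] take_words[of v n l k] kl by (auto simp: U_def V_def)
        with v show "v \<in> (\<Union>u\<in>U. {v \<in> words n l. take k v = u})" by (auto simp: V_def)
      qed
      then have "card V \<le> card (\<Union>u\<in>U. {v \<in> words n l. take k v = u})"
        using fin by (intro card_mono) (auto simp: finite_words)
      also have "\<dots> \<le> (\<Sum>u\<in>U. card {v \<in> words n l. take k v = u})"
        by (rule card_UN_le[OF fin(1)])
      also have "\<dots> = card U * (\<Prod>i=Suc k..l. n i)"
        using card_words_prefix[OF _ kl, where n = n] by (simp add: U_def)
      also have "\<dots> \<le> N"
        using M(2)[OF Rk, of x] by (simp add: N_def U_def)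
      finally have "card (p ` V) \<le> N"
        using card_image_le[OF fin(2), of p] by simp
      moreover have "p ` V \<subseteq> F" using p by (auto simp: V_def)
      moreover have "F \<inter> ball x R \<subseteq> (\<Union>y\<in>p ` V. F \<inter> ball y r)"
      proof
        fix y assume y: "y \<in> F \<inter> ball x R"
        then obtain v where v: "v \<in> words n l" "y \<in> \<J> v"
          using moran_set_covered[of y l] by blast
        then have "dist (p v) y \<le> diam l"
          using diameter_bounded_bound[OF cell_bounded[OF v(1)], of "p v" y] p[OF v(1)]
            diameter_cell[OF v(1)] by simp
        then have "y \<in> F \<inter> ball (p v) r" using Dlr y by simp
        moreover have "v \<in> V" using v y by (auto simp: V_def)
        ultimately show "y \<in> (\<Union>y\<in>p ` V. F \<inter> ball y r)" by blast
      qed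
      ultimately show "\<exists>T. T \<subseteq> F \<and> finite T \<and> card T \<le> N \<and> F \<inter> ball x R \<subseteq> (\<Union>y\<in>T. F \<inter> ball y r)"
        using fin by (intro exI[of _ "p ` V"]) auto
    qed
    then have "ereal_of_enat (covering_number r R F) \<le> ereal (real N)"
      by (metis ereal_of_enat_le_iff ereal_of_enat_simps(1))
    also have "real N \<le> C * (R / r) powr s"
    proof -
      \<comment> \<open>Some word of level \<open>k\<close> is wanted to turn the integer product in
        \<open>N\<close> into \<open>ncells l / ncells k\<close>.\<close>
      obtain x0 where "x0 \<in> F" using moran_set_meets_cell[of "[]" 0] by auto
      then obtain u where u: "u \<in> words n k" using moran_set_covered[of x0 k] by blast
      have "real N = M * (ncells l / ncells k)"
        using card_words_prefix_real[OF u kl] card_words_prefix[OF u kl] by (simp add: N_def)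
      also have "\<dots> \<le> M * (K * (diam k / diam l) powr s)"
        using growth[OF kl] by (intro mult_left_mono) auto
      also have "\<dots> \<le> M * (K * (R / (\<delta> * (r / 2))) powr s)"
      proof -
        have "diam k / diam l \<le> R / (\<delta> * (r / 2))"
          using Dk Dl rR \<delta>_pos diam_pos[of k] by (intro frac_le) auto
        then have "(diam k / diam l) powr s \<le> (R / (\<delta> * (r / 2))) powr s"
          using assms diam_pos[of k] diam_pos[of l] by (intro powr_mono2) auto
        then show ?thesis using assms by (simp add: mult_left_mono)
      qed
      also have "R / (\<delta> * (r / 2)) = 2 / \<delta> * (R / r)" by simp
      also have "(2 / \<delta> * (R / r)) powr s = (2 / \<delta>) powr s * (R / r) powr s"
        by (rule powr_mult)
      finally show ?thesis by (simp add: C_def mult_ac)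
    qed
    finally show ?thesis by simp
  qed
  show ?thesis
    unfolding assouad_dim_def
    by (rule Inf_lower) (use bound C diameter_J_pos \<open>s \<ge> 0\<close> in blast)
qed

text \<open>Around a point of \<open>F\<close> in a cell of level \<open>k\<close>, a ball of radius
  \<open>2 * diam k\<close> meets all cells of level \<open>l\<close> below that cell, and each
  covering ball of radius \<open>diam l\<close> meets boundedly many of them. The restriction
  \<open>R < b\<close> confines this to deep levels; the finitely many levels before
  \<open>k0\<close> are absorbed into the constant.\<close>

lemma growth_le_of_covering:
  assumes "\<alpha> \<ge> 0" "b > 0" "C > 0"
    and cov: "\<And>r R. 0 < r \<Longrightarrow> r < R \<Longrightarrow> R < b \<Longrightarrow>
      ereal_of_enat (covering_number r R F) \<le> ereal (C * (R / r) powr \<alpha>)"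
  obtains K where "K > 0" "\<And>k l. k \<le> l \<Longrightarrow> ncells l / ncells k \<le> K * (diam k / diam l) powr \<alpha>"
proof -
  obtain M :: nat where M: "M > 0"
    "\<And>k x R. R \<le> 1 * diam k \<Longrightarrow> card {u \<in> words n k. \<J> u \<inter> ball x R \<noteq> {}} \<le> M"
    using card_cells_meeting_ball[of 1] by auto
  \<comment> \<open>This ensures \<open>2 * diam k < b\<close> for all
    \<open>k \<ge> k0\<close>.\<close>
  obtain k0 where "diam k0 \<le> b / 3" using ex_diam_le[of "b / 3"] \<open>b > 0\<close> by auto
  define K where "K = M * C * 2 powr \<alpha>"
  have K: "K > 0" using M \<open>C > 0\<close> by (simp add: K_def)
  have deep: "ncells l / ncells k \<le> K * (diam k / diam l) powr \<alpha>" if "k0 \<le> k" "k \<le> l" for k l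
  proof -
    \<comment> \<open>The factor 2 lets the open ball contain points at distance exactly
      \<open>diam k\<close>, and gives \<open>r < R\<close> even for \<open>k = l\<close>.\<close>
    define r R where "r = diam l" and "R = 2 * diam k"
    have "diam k \<le> b / 3"
      using diam_antimono[OF \<open>k0 \<le> k\<close>] \<open>diam k0 \<le> b / 3\<close> by simp
    then have rR: "0 < r" "r < R" "R < b"
      using diam_antimono[OF \<open>k \<le> l\<close>] diam_pos[of k] diam_pos[of l] \<open>b > 0\<close> by (simp_all add: r_def R_def)
    obtain N where N: "covering_number r R F = enat N"
      using cov[OF rR] by (cases "covering_number r R F") auto
    with cov[OF rR] have N_le: "real N \<le> C * (R / r) powr \<alpha>" by simp
    obtain x0 where "x0 \<in> F" using moran_set_meets_cell[of "[]" 0] by auto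
    then obtain u where u: "u \<in> words n k" using moran_set_covered[of x0 k] by blast
    then obtain x where x: "x \<in> F" "x \<in> \<J> u" using moran_set_meets_cell[OF u] by blast
    obtain T where T: "T \<subseteq> F" "finite T" "card T \<le> N" "F \<inter> ball x R \<subseteq> (\<Union>y\<in>T. F \<inter> ball y r)"
      using covering_number_le_iff[of r R F N] N x(1) by auto
    have "{v \<in> words n l. take k v = u} \<subseteq> (\<Union>y\<in>T. {v \<in> words n l. \<J> v \<inter> ball y r \<noteq> {}})"
    proof
      fix v assume v: "v \<in> {v \<in> words n l. take k v = u}"
      then obtain p where p: "p \<in> F" "p \<in> \<J> v" using moran_set_meets_cell[of v l] by blast
      have "p \<in> \<J> u" using cell_prefix[OF \<open>k \<le> l\<close>, of v] v p by auto
      then have "dist x p \<le> diam k"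
        using diameter_bounded_bound[OF cell_bounded[OF u] x(2)] diameter_cell[OF u] by simp
      then have "p \<in> F \<inter> ball x R" using p diam_pos[of k] by (simp add: R_def)
      with T(4) obtain y where "y \<in> T" "p \<in> ball y r" by blast
      with v p show "v \<in> (\<Union>y\<in>T. {v \<in> words n l. \<J> v \<inter> ball y r \<noteq> {}})" by blast
    qed
    then have "card {v \<in> words n l. take k v = u} \<le> card (\<Union>y\<in>T. {v \<in> words n l. \<J> v \<inter> ball y r \<noteq> {}})"
      using T by (intro card_mono) (auto simp: finite_words)
    also have "\<dots> \<le> (\<Sum>y\<in>T. card {v \<in> words n l. \<J> v \<inter> ball y r \<noteq> {}})"
      by (rule card_UN_le[OF T(2)])
    also have "\<dots> \<le> card T * M"
      using sum_bounded_above[of T "\<lambda>y. card {v \<in> words n l. \<J> v \<inter> ball y r \<noteq> {}}" M]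
        M(2)[of r l] by (simp add: r_def)
    also have "\<dots> \<le> N * M" using T(3) by simp
    finally have "ncells l / ncells k \<le> real N * real M"
      unfolding card_words_prefix_real[OF u \<open>k \<le> l\<close>, symmetric] by (metis of_nat_le_iff of_nat_mult)
    also have "\<dots> \<le> C * (R / r) powr \<alpha> * real M"
      using N_le by (intro mult_right_mono) auto
    also have "R / r = 2 * (diam k / diam l)" by (simp add: R_def r_def)
    also have "(2 * (diam k / diam l)) powr \<alpha> = 2 powr \<alpha> * (diam k / diam l) powr \<alpha>"
      by (rule powr_mult)
    finally show ?thesis by (simp add: K_def mult_ac)
  qed
  have P1: "ncells k \<ge> 1" for k using ncells_mono[of 0 k] by simp
  show ?thesis
  \<comment> \<open>The factor \<open>ncells k0\<close> pays for starting above level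
    \<open>k0\<close>; the summand 1 serves the case \<open>l < k0\<close>, where only
    \<open>ncells l \<le> ncells k0\<close> is available and \<open>K\<close> may be below
    1.\<close>
  proof (rule that[of "ncells k0 * (K + 1)"])
    show "ncells k0 * (K + 1) > 0" using K ncells_pos by simp
    fix k l :: nat assume kl: "k \<le> l"
    define X where "X = (diam k / diam l) powr \<alpha>"
    have "1 \<le> diam k / diam l" using diam_antimono[OF kl] diam_pos[of l] by simp
    then have X: "X \<ge> 1" unfolding X_def using \<open>\<alpha> \<ge> 0\<close> by (rule ge_one_powr_ge_zero)
    have Pdiv: "ncells l / ncells k \<le> ncells l"
      using P1[of k] ncells_pos[of l] by (simp add: field_simps mult_le_cancel_left1)
    consider "k0 \<le> k" | "k < k0" "k0 \<le> l" | "l < k0" by linarith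
    then show "ncells l / ncells k \<le> ncells k0 * (K + 1) * (diam k / diam l) powr \<alpha>"
    proof cases
      case 1
      have "ncells l / ncells k \<le> K * X" using deep[OF 1 kl] by (simp add: X_def)
      also have "\<dots> \<le> ncells k0 * (K + 1) * X"
        using K X P1[of k0] mult_mono[of 1 "ncells k0" K "K + 1"] by (intro mult_right_mono) auto
      finally show ?thesis by (simp add: X_def)
    next
      case 2
      have "(diam k0 / diam l) powr \<alpha> \<le> X"
        unfolding X_def using diam_antimono[of k k0] 2 diam_pos[of k0] diam_pos[of l] \<open>\<alpha> \<ge> 0\<close>
        by (intro powr_mono2 divide_right_mono) auto
      then have "K * (diam k0 / diam l) powr \<alpha> \<le> (K + 1) * X"
        using K X by (intro mult_mono) auto
      then have "ncells l / ncells k0 \<le> (K + 1) * X" using deep[of k0 l] 2 by simp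
      then have "ncells l \<le> ncells k0 * (K + 1) * X" using ncells_pos[of k0] by (simp add: field_simps)
      with Pdiv show ?thesis by (simp add: X_def)
    next
      case 3
      have "ncells l \<le> ncells k0" using 3 ncells_mono by simp
      also have "\<dots> \<le> ncells k0 * ((K + 1) * X)"
        using K X ncells_pos[of k0] mult_mono[of 1 "K + 1" 1 X] by simp
      finally show ?thesis using Pdiv by (simp add: X_def mult_ac)
    qed
  qed
qed

section \<open>Logarithmic growth over blocks\<close>

lemma ln_ncells_ratio: "ln (ncells l / ncells k) = ln (ncells l) - ln (ncells k)"
  and ln_diam_ratio: "ln (diam k / diam l) = ln (diam k) - ln (diam l)"
  using ncells_pos diam_pos by (simp_all add: ln_divide_pos)

text \<open>The volume condition gives
  \<open>n k \<le> c k powr (- d) \<le> \<delta> powr (- d)\<close> in dimension \<open>d\<close>,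
  so each level adds a bounded amount.\<close>

lemma ln_ncells_diff_le:
  assumes "k \<le> l" shows "ln (ncells l) - ln (ncells k) \<le> DIM('a) * (- ln \<delta>) * (real l - real k)"
  using assms
proof (induction l rule: dec_induct)
  case (step l)
  have "ln (ncells (Suc l)) = ln (ncells l) + ln (n (Suc l))"
    using ncells_pos[of l] n_ge_2[of "Suc l"] by (simp add: ncells_Suc ln_mult)
  moreover have "ln (n (Suc l)) \<le> DIM('a) * (- ln \<delta>)"
  proof -
    have "- ln (c (Suc l)) \<le> - ln \<delta>"
      using \<delta>_le[of "Suc l"] \<delta>_pos by simp
    then have "DIM('a) * (- ln (c (Suc l))) \<le> DIM('a) * (- ln \<delta>)"
      by (intro mult_left_mono) auto
    then show ?thesis using ln_n_le[of "Suc l"] by linarith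
  qed
  ultimately show ?case
    using step.IH by (simp add: algebra_simps)
qed simp

text \<open>Blocks of length \<open>q\<close> are split off at the upper end \<open>k\<close> until
  fewer than \<open>q\<close> levels remain; this remainder costs the additive constant, independent
  of \<open>k\<close> and \<open>l\<close>.\<close>

lemma growth_of_block_growth:
  assumes "s \<ge> 0" "q > 0"
    and block: "\<And>k. ln (ncells (k + q)) - ln (ncells k) \<le> s * (ln (diam k) - ln (diam (k + q)))"
    and "k \<le> l"
  shows "ln (ncells l) - ln (ncells k) \<le> s * (ln (diam k) - ln (diam l)) + DIM('a) * (- ln \<delta>) * q"
  using \<open>k \<le> l\<close>
proof (induction "l - k" arbitrary: k rule: less_induct)
  case less
  show ?case
  proof (cases "l < k + q")
    case True
    have "ln (ncells l) - ln (ncells k) \<le> DIM('a) * (- ln \<delta>) * (real l - real k)"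
      by (rule ln_ncells_diff_le[OF less.prems])
    also have "\<dots> \<le> DIM('a) * (- ln \<delta>) * q"
      using True \<delta>_pos \<delta>_less_1 by (intro mult_left_mono) (auto simp: mult_nonneg_nonpos)
    finally have "ln (ncells l) - ln (ncells k) \<le> DIM('a) * (- ln \<delta>) * q" .
    moreover have "0 \<le> s * (ln (diam k) - ln (diam l))"
      using diam_antimono[OF less.prems] diam_pos[of k] diam_pos[of l] \<open>s \<ge> 0\<close> by simp
    ultimately show ?thesis by linarith
  next
    case False
    then have "ln (ncells l) - ln (ncells (k + q))
        \<le> s * (ln (diam (k + q)) - ln (diam l)) + DIM('a) * (- ln \<delta>) * q"
      using \<open>q > 0\<close> by (intro less.hyps) auto
    with block[of k] show ?thesis by (simp add: algebra_simps)
  qed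
qed

definition rate :: "nat \<Rightarrow> nat \<Rightarrow> real" where
  "rate k m = ln (\<Prod>i=k..k+m. real (n i)) / - ln (\<Prod>i=k..k+m. c i)"

lemma rate_eq:
  assumes "k \<ge> 1"
  shows "rate k m = (ln (ncells (k + m)) - ln (ncells (k - 1))) / (ln (diam (k - 1)) - ln (diam (k + m)))"
  using ln_ncells_ratio[of "k + m" "k - 1"] ln_diam_ratio[of "k + m" "k - 1"] assms
  by (simp add: rate_def ncells_block diam_block)

lemma rate_denominator_ge:
  assumes "k \<ge> 1" shows "\<gamma> * (real m + 1) \<le> ln (diam (k - 1)) - ln (diam (k + m))"
  using ln_diam_diff_ge[of "k - 1" "k + m"] assms by (simp add: of_nat_diff add.commute)

lemma rate_denominator_pos:
  assumes "k \<ge> 1" shows "ln (diam (k - 1)) - ln (diam (k + m)) > 0"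
  using rate_denominator_ge[OF assms, of m] \<gamma>_pos
  by (smt (verit) mult_pos_pos of_nat_0_le_iff)

text \<open>For fixed \<open>m\<close>, a finite supremum \<open>s\<close> bounds the growth over
  every block of \<open>m + 1\<close> levels with exponent \<open>s\<close>. The additive remainder
  becomes the factor \<open>exp B\<close> after exponentiation, so \<open>s\<close> is
  admissible.\<close>

lemma assouad_dim_le_SUP_rate: "assouad_dim F \<le> (SUP k\<in>{1..}. ereal (rate k m))"
proof (cases "SUP k\<in>{1..}. ereal (rate k m)")
  case (real s)
  have rate_le: "rate k m \<le> s" if "k \<ge> 1" for k
  proof -
    have "ereal (rate k m) \<le> (SUP k\<in>{1..}. ereal (rate k m))"
      using that by (intro SUP_upper) simp
    with real show ?thesis by simp
  qed
  have "0 \<le> rate 1 m"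
    using rate_eq[of 1 m] rate_denominator_pos[of 1 m] ncells_mono[of 0 "1 + m"] by simp
  then have s: "s \<ge> 0" using rate_le[of 1] by simp
  have block: "ln (ncells (k + (m + 1))) - ln (ncells k) \<le> s * (ln (diam k) - ln (diam (k + (m + 1))))" for k
    using rate_le[of "Suc k"] rate_eq[of "Suc k" m] rate_denominator_pos[of "Suc k" m]
    by (simp add: pos_divide_le_eq)
  define B where "B = DIM('a) * (- ln \<delta>) * real (m + 1)"
  have "assouad_dim F \<le> ereal s"
  proof (rule assouad_dim_le[OF s, of "exp B"])
    fix k l :: nat assume "k \<le> l"
    have "ncells l / ncells k = exp (ln (ncells l) - ln (ncells k))"
      using ncells_pos[of k] ncells_pos[of l] by (simp add: exp_diff)
    also have "\<dots> \<le> exp (s * (ln (diam k) - ln (diam l)) + B)"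
      using growth_of_block_growth[OF s _ block \<open>k \<le> l\<close>] by (simp add: B_def)
    also have "\<dots> = exp B * (diam k / diam l) powr s"
      using diam_pos[of k] diam_pos[of l] by (simp add: powr_def exp_add ln_diam_ratio)
    finally show "ncells l / ncells k \<le> exp B * (diam k / diam l) powr s" .
  qed simp
  then show ?thesis unfolding real .
next
  case MInf
  then have "ereal (rate 1 m) \<le> - \<infinity>"
    by (metis SUP_upper atLeast_iff order_refl)
  then show ?thesis by simp
qed simp

text \<open>Taking logarithms in the growth bound and dividing by a denominator that is at least
  \<open>\<gamma> * (m + 1)\<close> leaves an error of order \<open>1 / m\<close>, uniform in
  \<open>k\<close>.\<close>

lemma limsup_SUP_rate_le:
  assumes "\<alpha> \<ge> 0" "K > 0" and growth: "\<And>k l. k \<le> l \<Longrightarrow> ncells l / ncells k \<le> K * (diam k / diam l) powr \<alpha>"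
  shows "limsup (\<lambda>m. SUP k\<in>{1..}. ereal (rate k m)) \<le> ereal \<alpha>"
proof -
  \<comment> \<open>The absolute value makes \<open>L / g\<close> increase when \<open>g\<close> is
    replaced by its lower bound.\<close>
  define L where "L = \<bar>ln K\<bar>"
  have "rate k m \<le> \<alpha> + L / (\<gamma> * (real m + 1))" if k: "k \<ge> 1" for k m
  proof -
    define g where "g = ln (diam (k - 1)) - ln (diam (k + m))"
    have g: "g > 0" "\<gamma> * (real m + 1) \<le> g"
      using rate_denominator_pos[OF k] rate_denominator_ge[OF k] by (simp_all add: g_def)
    have "ln (ncells (k + m) / ncells (k - 1)) \<le> ln (K * (diam (k - 1) / diam (k + m)) powr \<alpha>)"
      using growth[of "k - 1" "k + m"] ncells_pos[of "k - 1"] ncells_pos[of "k + m"] by (intro ln_mono) auto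
    also have "\<dots> = ln K + \<alpha> * g"
      using \<open>K > 0\<close> diam_pos[of "k - 1"] diam_pos[of "k + m"] by (simp add: g_def ln_mult ln_powr ln_diam_ratio)
    finally have "ln (ncells (k + m)) - ln (ncells (k - 1)) \<le> L + \<alpha> * g"
      unfolding ln_ncells_ratio by (simp add: L_def)
    then have "rate k m \<le> (L + \<alpha> * g) / g"
      unfolding rate_eq[OF k] g_def[symmetric] using g by (intro divide_right_mono) auto
    also have "\<dots> = \<alpha> + L / g" using g by (simp add: field_simps)
    also have "L / g \<le> L / (\<gamma> * (real m + 1))"
      using g \<gamma>_pos by (intro divide_left_mono mult_pos_pos) (auto simp: L_def)
    finally show ?thesis by simp
  qed
  then have "(SUP k\<in>{1..}. ereal (rate k m)) \<le> ereal (\<alpha> + L / (\<gamma> * (real m + 1)))" for m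
    by (intro SUP_least) simp
  then have "limsup (\<lambda>m. SUP k\<in>{1..}. ereal (rate k m))
      \<le> limsup (\<lambda>m. ereal (\<alpha> + L / (\<gamma> * (real m + 1))))"
    by (intro Limsup_mono always_eventually allI)
  also have "\<dots> = ereal \<alpha>"
  proof (rule lim_imp_Limsup)
    have "(\<lambda>m. \<alpha> + L / \<gamma> * inverse (real (Suc m))) \<longlonglongrightarrow> \<alpha> + L / \<gamma> * 0"
      by (intro tendsto_intros LIMSEQ_inverse_real_of_nat)
    then show "(\<lambda>m. ereal (\<alpha> + L / (\<gamma> * (real m + 1)))) \<longlonglongrightarrow> ereal \<alpha>"
      by (intro tendsto_ereal) (simp add: field_simps)
  qed simp
  finally show ?thesis .
qed

text \<open>The limit superior lies below every admissible exponent, hence below their infimum,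
  while each term of the sequence is at least the dimension; so both limits agree with it.\<close>

lemma SUP_rate_tendsto: "(\<lambda>m. SUP k\<in>{1..}. ereal (rate k m)) \<longlonglongrightarrow> assouad_dim F"
proof -
  let ?f = "\<lambda>m. SUP k\<in>{1..}. ereal (rate k m)"
  have "limsup ?f \<le> assouad_dim F"
    unfolding assouad_dim_def
  proof (rule Inf_greatest, clarify)
    fix \<alpha> b C :: real
    assume *: "0 \<le> \<alpha>" "0 < b" "0 < C" "\<forall>r R. 0 < r \<and> r < R \<and> R < b \<longrightarrow>
      ereal_of_enat (covering_number r R F) \<le> ereal (C * (R / r) powr \<alpha>)"
    obtain K where "K > 0" "\<And>k l. k \<le> l \<Longrightarrow> ncells l / ncells k \<le> K * (diam k / diam l) powr \<alpha>"
      using growth_le_of_covering[OF *(1-3)] *(4) by metis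
    then show "limsup ?f \<le> ereal \<alpha>"
      by (rule limsup_SUP_rate_le[OF *(1)])
  qed
  moreover have "assouad_dim F \<le> liminf ?f"
    by (intro Liminf_bounded always_eventually allI assouad_dim_le_SUP_rate)
  moreover have "liminf ?f \<le> limsup ?f"
    by (intro Liminf_le_Limsup) simp
  ultimately show ?thesis
    by (intro Liminf_eq_Limsup) (auto intro: antisym)
qed

end

section \<open>The dimension formula\<close>

theorem corollary1:
  fixes J :: "'a::euclidean_space set"
    and n :: "nat \<Rightarrow> nat"
    and \<phi> :: "nat \<Rightarrow> nat \<Rightarrow> real"
    and c :: "nat \<Rightarrow> real"
    and F :: "'a set"
  assumes "moran_data J n \<phi>"
    and "0 < (INF (i, j) \<in> (SIGMA i:{1..}. {1..n i}). \<phi> i j)"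
    and "\<forall>k\<ge>1. \<forall>j\<in>{1..n k}. \<phi> k j = c k"
    and "F \<in> moran_class J n \<phi>"
  shows "(\<lambda>m. SUP k\<in>{1..}. ereal (ln (\<Prod>i=k..k+m. real (n i)) / - ln (\<Prod>i=k..k+m. c i)))
           \<longlonglongrightarrow> assouad_dim F"
proof -
  obtain \<J> where \<J>: "moran_structure J n \<phi> \<J>" "F = moran_set n \<J>"
    using assms(4) unfolding moran_class_def by blast
  let ?I = "SIGMA i:{1..}. {1..n i}"
  define \<delta> where "\<delta> = (INF (i, j) \<in> ?I. \<phi> i j)"
  \<comment> \<open>A real-valued \<open>INF\<close> is known to be a lower bound only for a family
    bounded below; positivity of the ratios provides this.\<close>
  have bdd: "bdd_below ((\<lambda>(i, j). \<phi> i j) ` ?I)"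
  proof (rule bdd_belowI[of _ 0])
    fix x assume "x \<in> (\<lambda>(i, j). \<phi> i j) ` ?I"
    then obtain i j where ij: "i \<in> {1..}" "j \<in> {1..n i}" "x = \<phi> i j" by auto
    then have "\<phi> i j > 0" using assms(1) by (simp add: moran_data_def)
    then show "0 \<le> x" using ij(3) by simp
  qed
  have "\<delta> \<le> c k" if "k \<ge> 1" for k
  proof -
    have "n k \<ge> 2" using assms(1) that unfolding moran_data_def by blast
    then have "(k, 1) \<in> ?I" using that by simp
    from cINF_lower[OF bdd this] show ?thesis
      using assms(3) that \<open>n k \<ge> 2\<close> by (simp add: \<delta>_def)
  qed
  then interpret homogeneous_moran J n \<phi> c \<J> \<delta>
  proof unfold_locales
    show "0 < \<delta>" using assms(2) unfolding \<delta>_def .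
  qed (use assms(1,3) \<J>(1) in simp_all)
  show ?thesis
    using SUP_rate_tendsto by (simp only: rate_def \<J>(2))
qed

end
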